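(* Let $\mathcal{F}$ be an $n\times m$ Ferrers diagram and let $1\le r\le\min\{n,m\}$ be an integer with $\kappa(\mathcal{F},r)\ge 1$. Then the trailing degree $\tau(\mathcal{F},r)$ of the $r$-th $q$-rook polynomial of $\mathcal{F}$ satisfies $$\tau(\mathcal{F},r)=\sum_{i=1}^{m+n-1}\max\{0,|D_i\cap\mathcal{F}|-r\}.$$
   Context: For a positive integer $i$, $[i]=\{1,\dots,i\}$. An $n\times m$ Ferrers diagram is a subset $\mathcal{F}\subseteq[n]\times[m]$ such that $(1,1),(n,m)\in\mathcal{F}$; if $(i,j)\in\mathcal{F}$ and $j<m$ then $(i,j+1)\in\mathcal{F}$; and if $(i,j)\in\mathcal{F}$ and $i>1$ then $(i-1,j)\in\mathcal{F}$. Let $c_j=|\{i:(i,j)\in\mathcal{F}\}|$ for $1\le j\le m$. For $1\le d\le\min\{n,m\}$ and $0\le j\le d-1$ set $\kappa_j(\mathcal{F},d)=\sum_{t=1}^{m-d+1+j}\max\{c_t-j,0\}$ and $\kappa(\mathcal{F},d)=\min_{0\le j\le d-1}\kappa_j(\mathcal{F},d)$. For $1\le r\le m+n-1$ the $r$-th diagonal is $D_r=\{(i,j)\in[n]\times[m]: j-i=m-r\}$. A non-attacking rook placement is a subset $C\subseteq[n]\times[m]$ in which no two elements share a row index or a column index. For such $C\subseteq\mathcal{F}$, $\mathrm{inv}(C,\mathcal{F})$ is the number of elements $(a,b)\in\mathcal{F}$ that are not "crossed out", where $(a,b)$ is crossed out if there is $(i,j)\in C$ with either ($b=j$ and $a\le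 i$) or ($a=i$ and $b\ge j$) (i.e. it is a rook, or lies above a rook in its column, or to the right of a rook in its row). The $r$-th $q$-rook polynomial is $R_q(\mathcal{F},r)=\sum_{C}q^{\mathrm{inv}(C,\mathcal{F})}\in\mathbb{Z}[q]$, the sum over all non-attacking rook placements $C\subseteq\mathcal{F}$ with $|C|=r$; $\tau(\mathcal{F},r)$ denotes its trailing degree (the least exponent with nonzero coefficient). *)

theory Defs
  imports "HOL-Computational_Algebra.Polynomial"
begin

text \<open>
  A cell \<open>(i, j)\<close> is in row \<open>i\<close> and column \<open>j\<close>, both counted from 1, with row 1 at the top;
  Ferrers diagrams are aligned to the top and to the right.
\<close>

definition ferrers_diagram :: "nat \<Rightarrow> nat \<Rightarrow> (nat \<times> nat) set \<Rightarrow> bool" where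
  "ferrers_diagram n m F \<longleftrightarrow>
     F \<subseteq> {1..n} \<times> {1..m} \<and> (1, 1) \<in> F \<and> (n, m) \<in> F \<and>
     (\<forall>i j. (i, j) \<in> F \<and> j < m \<longrightarrow> (i, j + 1) \<in> F) \<and>
     (\<forall>i j. (i, j) \<in> F \<and> i > 1 \<longrightarrow> (i - 1, j) \<in> F)"

definition col_len :: "(nat \<times> nat) set \<Rightarrow> nat \<Rightarrow> nat" where
  "col_len F j = card {i. (i, j) \<in> F}"

text \<open>\<open>kappa_j\<close> and \<open>kappa\<close> are meant for \<open>1 \<le> d \<le> m\<close> and \<open>j < d\<close>, where \<open>m - d\<close> does not truncate.\<close>

definition kappa_j :: "nat \<Rightarrow> (nat \<times> nat) set \<Rightarrow> nat \<Rightarrow> nat \<Rightarrow> int" where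
  "kappa_j m F d j = (\<Sum>t = 1..m - d + 1 + j. max (int (col_len F t) - int j) 0)"

definition kappa :: "nat \<Rightarrow> (nat \<times> nat) set \<Rightarrow> nat \<Rightarrow> int" where
  "kappa m F d = Min (kappa_j m F d ` {0..d - 1})"

definition diagonal :: "nat \<Rightarrow> nat \<Rightarrow> nat \<Rightarrow> (nat \<times> nat) set" where
  "diagonal n m r = {(i, j) \<in> {1..n} \<times> {1..m}. int j - int i = int m - int r}"

definition nonattacking :: "nat \<Rightarrow> nat \<Rightarrow> (nat \<times> nat) set \<Rightarrow> bool" where
  "nonattacking n m C \<longleftrightarrow>
     C \<subseteq> {1..n} \<times> {1..m} \<and>
     (\<forall>x\<in>C. \<forall>y\<in>C. x \<noteq> y \<longrightarrow> fst x \<noteq> fst y \<and> snd x \<noteq> snd y)"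

definition crossed_out :: "(nat \<times> nat) set \<Rightarrow> nat \<times> nat \<Rightarrow> bool" where
  "crossed_out C = (\<lambda>(a, b). \<exists>(i, j)\<in>C. (b = j \<and> a \<le> i) \<or> (a = i \<and> b \<ge> j))"

definition rook_inv :: "(nat \<times> nat) set \<Rightarrow> (nat \<times> nat) set \<Rightarrow> nat" where
  "rook_inv C F = card {x \<in> F. \<not> crossed_out C x}"

definition q_rook_poly :: "nat \<Rightarrow> nat \<Rightarrow> (nat \<times> nat) set \<Rightarrow> nat \<Rightarrow> int poly" where
  "q_rook_poly n m F r =
     (\<Sum>C | C \<subseteq> F \<and> nonattacking n m C \<and> card C = r. monom 1 (rook_inv C F))"

text \<open>For the zero polynomial the value is unspecified.\<close>

definition trailing_degree :: "'a::zero poly \<Rightarrow> nat" where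
  "trailing_degree p = (LEAST k. coeff p k \<noteq> 0)"

end

theory Submission
  imports Defs
begin

text \<open>
  Only the set \<open>S\<close> of columns holding a rook matters: every rook should occupy the lowest row of its
  column that is still free, and then the uncrossed cells lie in the columns \<open>b \<notin> S\<close>, where there
  are \<open>c\<^sub>b - |S \<inter> {..<b}|\<close> of them. The sets \<open>S\<close> that carry a placement are the independent sets of
  a matroid, given by \<open>|S \<inter> {..x}| \<le> c\<^sub>x\<close> for all \<open>x\<close>. Up to constants the number of uncrossed cells
  is the negative of the weight \<open>\<Sum>s\<in>S. c\<^sub>s - s\<close>, so a minimum is found greedily. The columns with
  \<open>c\<^sub>s - s \<ge> i - m\<close> contain those meeting \<open>D\<^sub>i \<inter> F\<close>, and for \<open>i \<ge> r\<close> the latter form an independent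
  set which has, up to truncation at \<open>r\<close>, the rank of the former. The condition on \<open>kappa\<close> says
  that \<open>D\<^sub>r \<subseteq> F\<close>, so the greedy choice among the diagonals \<open>i \<ge> r\<close> already yields \<open>r\<close> columns.
\<close>

section \<open>Auxiliary facts on finite sets, sums and trailing degrees\<close>

lemma down_closed_eq_atLeastAtMost_card:
  fixes X :: "nat set"
  assumes "finite X" and "0 \<notin> X" and down: "\<And>a. a \<in> X \<Longrightarrow> a > 1 \<Longrightarrow> a - 1 \<in> X"
  shows "X = {1..card X}"
proof (cases "X = {}")
  case False
  define M where "M = Max X"
  have M: "M \<in> X" "\<And>a. a \<in> X \<Longrightarrow> a \<le> M"
    using assms(1) False by (auto simp: M_def)
  have "1 \<le> a \<Longrightarrow> a \<in> X" if "a \<le> M" for a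
    using that
  proof (induction a rule: inc_induct)
    case base
    then show ?case using M by simp
  next
    case (step k)
    then show ?case using down[of "Suc k"] by simp
  qed
  moreover have "a \<ge> 1" if "a \<in> X" for a
    using that \<open>0 \<notin> X\<close> by (cases a) auto
  ultimately have "X = {1..M}"
    using M(2) unfolding set_eq_iff atLeastAtMost_iff by blast
  then show ?thesis by simp
qed simp

text \<open>In increasing order the elements have 0, 1, 2, ... predecessors.\<close>

lemma sum_card_less_elements:
  fixes S :: "nat set"
  assumes "finite S"
  shows "(\<Sum>b\<in>S. card (S \<inter> {..<b})) = (\<Sum>k<card S. k)"
  using assms
proof (induction rule: finite_linorder_max_induct)
  case (insert b A)
  have "insert b A \<inter> {..<b} = A"
    using insert by auto
  moreover have "(\<Sum>x\<in>A. card (insert b A \<inter> {..<x})) = (\<Sum>x\<in>A. card (A \<inter> {..<x}))"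
    using insert by (intro sum.cong refl arg_cong[where f = card]) force
  moreover have "b \<notin> A" using insert by auto
  ultimately show ?case using insert by simp
qed simp

text \<open>Truncated subtraction kills the terms beyond \<open>r\<close>. This serves to spread the
  number of pairs in an \<open>r\<close>-element set over the diagonal indices.\<close>

lemma sum_diff_atLeastAtMost:
  fixes r N :: nat
  assumes "r \<le> N"
  shows "(\<Sum>i = 1..N. r - i) = (\<Sum>k<r. k)"
proof -
  have "(\<Sum>i = 1..N. r - i) = (\<Sum>i = 1..r. r - i)"
    by (rule sum.mono_neutral_right) (use assms in auto)
  also have "\<dots> = (\<Sum>k<r. k)"
    by (rule sum.reindex_bij_witness[of _ "\<lambda>k. r - k" "\<lambda>i. r - i"]) auto
  finally show ?thesis .
qed

lemma sum_card_filter_swap: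
  assumes "finite A" "finite B"
  shows "(\<Sum>a\<in>A. card {b \<in> B. P a b}) = (\<Sum>b\<in>B. card {a \<in> A. P a b})"
  using sum.swap_restrict[OF assms, of "\<lambda>_ _. 1 :: nat" P] by simp

text \<open>Each coefficient counts terms, so no cancellation can hide the least exponent.\<close>

lemma trailing_degree_sum_monom:
  fixes f :: "'a \<Rightarrow> nat"
  assumes "finite A" and "x \<in> A" and "\<And>y. y \<in> A \<Longrightarrow> f x \<le> f y"
  shows "trailing_degree (\<Sum>y\<in>A. monom (1 :: int) (f y)) = f x"
proof -
  have coeff: "coeff (\<Sum>y\<in>A. monom (1 :: int) (f y)) k = int (card {y \<in> A. f y = k})" for k
    using assms(1) by (simp add: coeff_sum sum.If_cases Int_def)
  show ?thesis
    unfolding trailing_degree_def coeff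
    by (rule Least_equality) (use assms in \<open>auto simp: card_eq_0_iff\<close>)
qed

lemma nonattacking_inj_on:
  assumes "nonattacking n m C"
  shows "inj_on fst C" "inj_on snd C"
  using assms unfolding nonattacking_def inj_on_def by blast+

section \<open>Column heights of a Ferrers diagram\<close>

locale ferrers =
  fixes n m :: nat and F :: "(nat \<times> nat) set"
  assumes ferrers: "ferrers_diagram n m F"
begin

abbreviation c :: "nat \<Rightarrow> nat" where "c \<equiv> col_len F"

lemma subset_F: "F \<subseteq> {1..n} \<times> {1..m}"
  and corners: "(1, 1) \<in> F" "(n, m) \<in> F"
  and closed_right: "(i, j) \<in> F \<Longrightarrow> j < m \<Longrightarrow> (i, j + 1) \<in> F"
  and closed_up: "(i, j) \<in> F \<Longrightarrow> i > 1 \<Longrightarrow> (i - 1, j) \<in> F"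
  using ferrers unfolding ferrers_diagram_def by blast+

lemma finite_F: "finite F"
  using subset_F by (rule finite_subset) simp

lemma mem_F_iff: "(a, t) \<in> F \<longleftrightarrow> t \<in> {1..m} \<and> a \<in> {1..c t}"
proof -
  have "{a. (a, t) \<in> F} = {1..c t}"
    unfolding col_len_def
  proof (rule down_closed_eq_atLeastAtMost_card)
    show "finite {a. (a, t) \<in> F}"
      by (rule finite_subset[of _ "{1..n}"]) (use subset_F in auto)
    show "0 \<notin> {a. (a, t) \<in> F}"
      using subset_F by auto
    show "a - 1 \<in> {a. (a, t) \<in> F}" if "a \<in> {a. (a, t) \<in> F}" "a > 1" for a
      using that closed_up by simp
  qed
  then show ?thesis
    using subset_F by blast
qed

lemma c_mono:
  assumes "1 \<le> s" "s \<le> t" "t \<le> m"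
  shows "c s \<le> c t"
  using assms(2,3)
proof (induction t rule: dec_induct)
  case (step k)
  have "c k \<le> c (Suc k)"
  proof (cases "c k = 0")
    case False
    then have "(c k, k) \<in> F" using step assms(1) by (simp add: mem_F_iff)
    then have "(c k, Suc k) \<in> F"
      using closed_right[of "c k" k] step by simp
    then show ?thesis by (simp add: mem_F_iff)
  qed simp
  then show ?case using step by simp
qed simp

lemma c_bounds:
  assumes "t \<in> {1..m}"
  shows "1 \<le> c t" "c t \<le> n"
proof -
  have "1 \<le> c 1" using corners(1) by (simp add: mem_F_iff)
  with c_mono[of 1 t] assms show *: "1 \<le> c t" by simp
  then have "(c t, t) \<in> F" using assms by (simp add: mem_F_iff)
  then show "c t \<le> n" using subset_F by auto
qed

lemma n_pos: "n \<ge> 1"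
  using corners(2) subset_F by auto

text \<open>If some \<open>k\<close> fails, monotonicity bounds all columns up to
  \<open>m - r + k\<close> by \<open>k - 1\<close>, so \<open>kappa_j\<close> at index
  \<open>k - 1\<close> vanishes. The cells \<open>(k, m - r + k)\<close> are those of the
  \<open>r\<close>-th diagonal, which therefore lies in \<open>F\<close>.\<close>

lemma kappa_pos_imp_le_c:
  assumes "1 \<le> r" "r \<le> m" "kappa m F r \<ge> 1" "k \<in> {1..r}"
  shows "k \<le> c (m - r + k)"
proof (rule ccontr)
  assume less: "\<not> k \<le> c (m - r + k)"
  have len: "m - r + 1 + (k - 1) = m - r + k" using assms by auto
  have "kappa m F r \<le> kappa_j m F r (k - 1)"
    unfolding kappa_def by (rule Min_le) (use assms in auto)
  also have "\<dots> = 0"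
    unfolding kappa_j_def len
  proof (rule sum.neutral, rule ballI)
    fix t assume "t \<in> {1..m - r + k}"
    then have "c t \<le> c (m - r + k)" using assms by (intro c_mono) auto
    then show "max (int (c t) - int (k - 1)) 0 = 0" using less by linarith
  qed
  finally show False using assms(3) by simp
qed

section \<open>Diagonals, column weights and free cells\<close>

text \<open>The \<open>i\<close>-th diagonal meets column \<open>t\<close> in row
  \<open>t + i - m\<close>; the inequalities keep this row between 1 and \<open>c t\<close>, in
  additive form to avoid truncation.\<close>

definition diag_cols :: "nat \<Rightarrow> nat set" where
  "diag_cols i = {t \<in> {1..m}. m < t + i \<and> t + i \<le> c t + m}"

text \<open>An upper level set of the weight \<open>c t - t\<close>. It exceeds
  \<open>diag_cols i\<close> only by columns where the diagonal would run above row 1.\<close>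

definition heavy_cols :: "nat \<Rightarrow> nat set" where
  "heavy_cols i = {t \<in> {1..m}. t + i \<le> c t + m}"

lemma finite_cols [simp]: "finite (diag_cols i)" "finite (heavy_cols i)"
  by (simp_all add: diag_cols_def heavy_cols_def)

lemma card_diagonal: "card (diagonal n m i \<inter> F) = card (diag_cols i)"
proof (rule bij_betw_same_card[of snd], rule bij_betw_imageI)
  show "inj_on snd (diagonal n m i \<inter> F)"
    by (auto simp: inj_on_def diagonal_def)
  show "snd ` (diagonal n m i \<inter> F) = diag_cols i"
  proof (intro equalityI subsetI)
    fix t assume "t \<in> diag_cols i"
    then have "(t + i - m, t) \<in> diagonal n m i \<inter> F"
      using c_bounds[of t] by (auto simp: diag_cols_def diagonal_def mem_F_iff)
    then show "t \<in> snd ` (diagonal n m i \<inter> F)" by force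
  qed (auto simp: diag_cols_def diagonal_def mem_F_iff)
qed

lemma sum_card_diag_cols: "(\<Sum>i = 1..m + n - 1. card (diag_cols i)) = (\<Sum>t = 1..m. c t)"
proof -
  have "(\<Sum>i = 1..m + n - 1. card (diag_cols i)) =
      (\<Sum>t = 1..m. card {i \<in> {1..m + n - 1}. m < t + i \<and> t + i \<le> c t + m})"
    unfolding diag_cols_def by (rule sum_card_filter_swap) simp_all
  also have "\<dots> = (\<Sum>t = 1..m. c t)"
  proof (rule sum.cong[OF refl])
    fix t assume t: "t \<in> {1..m}"
    then have "{i \<in> {1..m + n - 1}. m < t + i \<and> t + i \<le> c t + m} = {m - t + 1..m - t + c t}"
      using c_bounds[OF t] by auto
    then show "card {i \<in> {1..m + n - 1}. m < t + i \<and> t + i \<le> c t + m} = c t"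
      by simp
  qed
  finally show ?thesis .
qed

text \<open>Layer-cake count: column \<open>s\<close> is heavy for the positive indices up to
  \<open>c s + (m - s)\<close>, which is at most \<open>m + n - 1\<close>.\<close>

lemma sum_card_heavy_cols:
  assumes "S \<subseteq> {1..m}"
  shows "(\<Sum>i = 1..m + n - 1. card (S \<inter> heavy_cols i)) = (\<Sum>s\<in>S. c s + (m - s))"
proof -
  have "S \<inter> heavy_cols i = {t \<in> S. t + i \<le> c t + m}" for i
    using assms by (auto simp: heavy_cols_def)
  then have "(\<Sum>i = 1..m + n - 1. card (S \<inter> heavy_cols i)) =
      (\<Sum>s\<in>S. card {i \<in> {1..m + n - 1}. s + i \<le> c s + m})"
    using sum_card_filter_swap[of "{1..m + n - 1}" S] finite_subset[OF assms] by simp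
  also have "\<dots> = (\<Sum>s\<in>S. c s + (m - s))"
  proof (rule sum.cong[OF refl])
    fix s assume "s \<in> S"
    then have s: "s \<in> {1..m}" using assms by auto
    then have "{i \<in> {1..m + n - 1}. s + i \<le> c s + m} = {1..c s + (m - s)}"
      using c_bounds[OF s] by auto
    then show "card {i \<in> {1..m + n - 1}. s + i \<le> c s + m} = c s + (m - s)"
      by simp
  qed
  finally show ?thesis .
qed

text \<open>Counts the uncrossed cells outside the columns \<open>S\<close> of a placement: such a
  column loses one cell to each rook on its left. Integer differences keep the expression additive
  for every \<open>S\<close>.\<close>

definition free_cells :: "nat set \<Rightarrow> int" where
  "free_cells S = (\<Sum>b\<in>{1..m} - S. int (c b) - int (card (S \<inter> {..<b})))"

text \<open>The sum is extended to all columns and its part over \<open>S\<close> removed. The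
  resulting counts of cells, weights and pairs are each distributed over the diagonals, so that
  minimising can proceed one diagonal at a time.\<close>

lemma free_cells_eq_sum_diagonals:
  assumes S: "S \<subseteq> {1..m}"
  shows "free_cells S = (\<Sum>i = 1..m + n - 1.
    int (card (diag_cols i)) - int (card (S \<inter> heavy_cols i)) + int (card S - i))"
proof -
  have fin: "finite S" using S finite_subset by blast
  have "card S \<le> m" using card_mono[OF _ S] by simp
  then have "card S \<le> m + n - 1" using n_pos by simp
  \<comment> \<open>Both sums count the pairs in \<open>S\<close>; the truncated one needs a range
    reaching \<open>card S\<close>.\<close>
  note pairs = sum_diff_atLeastAtMost[OF this] sum_card_less_elements[OF fin]
  have "(\<Sum>b = 1..m. card (S \<inter> {..<b})) = (\<Sum>b = 1..m. card {s \<in> S. s < b})"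
    by (intro sum.cong refl arg_cong[where f = card]) auto
  also have "\<dots> = (\<Sum>s\<in>S. card {b \<in> {1..m}. s < b})"
    by (rule sum_card_filter_swap) (use fin in simp_all)
  also have "\<dots> = (\<Sum>s\<in>S. m - s)"
  proof (rule sum.cong[OF refl])
    fix s
    have "{b \<in> {1..m}. s < b} = {s + 1..m}" by auto
    then show "card {b \<in> {1..m}. s < b} = m - s" by simp
  qed
  finally have left: "(\<Sum>b = 1..m. card (S \<inter> {..<b})) = (\<Sum>s\<in>S. m - s)" .
  have "free_cells S = (\<Sum>b = 1..m. int (c b) - int (card (S \<inter> {..<b}))) -
      (\<Sum>b\<in>S. int (c b) - int (card (S \<inter> {..<b})))"
    unfolding free_cells_def by (rule sum_diff) (use S in simp_all)
  also have "\<dots> = int (\<Sum>b = 1..m. c b) - int (\<Sum>b = 1..m. card (S \<inter> {..<b}))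
      - int (\<Sum>b\<in>S. c b) + int (\<Sum>b\<in>S. card (S \<inter> {..<b}))"
    by (simp only: sum_subtractf of_nat_sum)
  also have "\<dots> = int (\<Sum>i = 1..m + n - 1. card (diag_cols i))
      - int (\<Sum>i = 1..m + n - 1. card (S \<inter> heavy_cols i)) + int (\<Sum>i = 1..m + n - 1. card S - i)"
    by (simp only: left pairs sum_card_diag_cols sum_card_heavy_cols[OF S] sum.distrib of_nat_add)
  also have "\<dots> = (\<Sum>i = 1..m + n - 1.
    int (card (diag_cols i)) - int (card (S \<inter> heavy_cols i)) + int (card S - i))"
    by (simp only: sum_subtractf sum.distrib of_nat_sum)
  finally show ?thesis .
qed

section \<open>The matroid of column sets\<close>

text \<open>Hall's condition for assigning distinct rows; as the columns are nested, initial
  segments suffice.\<close>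

definition independent :: "nat set \<Rightarrow> bool" where
  "independent S \<longleftrightarrow> S \<subseteq> {1..m} \<and> (\<forall>x\<in>{1..m}. card (S \<inter> {..x}) \<le> c x)"

lemma independent_finite: "independent S \<Longrightarrow> finite S"
  unfolding independent_def using finite_subset by blast

text \<open>If \<open>t\<close> is the largest member up to \<open>x\<close>, at most
  \<open>t + i - m\<close> members lie up to \<open>t\<close>, and this row number is at most
  \<open>c t\<close>.\<close>

lemma independent_diag_cols: "independent (diag_cols i)"
  unfolding independent_def
proof (intro conjI ballI)
  show "diag_cols i \<subseteq> {1..m}"
    unfolding diag_cols_def by (rule Collect_subset)
  fix x assume x: "x \<in> {1..m}"
  let ?A = "diag_cols i \<inter> {..x}"
  show "card ?A \<le> c x"
  proof (cases "?A = {}")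
    case False
    define t where "t = Max ?A"
    have t: "t \<in> ?A" unfolding t_def by (rule Max_in) (use False in simp_all)
    have "?A \<subseteq> {max 1 (m + 1 - i)..t}"
    proof
      fix s assume "s \<in> ?A"
      moreover from this have "s \<le> t" unfolding t_def by (intro Max_ge) simp_all
      ultimately show "s \<in> {max 1 (m + 1 - i)..t}" by (auto simp: diag_cols_def)
    qed
    then have "card ?A \<le> t + 1 - max 1 (m + 1 - i)"
      using card_mono[of "{max 1 (m + 1 - i)..t}" ?A] by simp
    also have "\<dots> \<le> c t"
      using t by (auto simp: diag_cols_def)
    also have "\<dots> \<le> c x"
      using t x by (intro c_mono) (auto simp: diag_cols_def)
    finally show ?thesis .
  qed (simp only: card.empty zero_le)
qed

text \<open>
  Beyond the last index at which \<open>I\<close> is tight every element of \<open>J - I\<close> may be added to \<open>I\<close>, and up to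
  that index \<open>J\<close> is no larger than \<open>I\<close>.
\<close>
lemma independent_augment:
  assumes I: "independent I" and J: "independent J" and less: "card I < card J"
  shows "\<exists>j \<in> J - I. independent (insert j I)"
proof -
  note fin = independent_finite[OF I] independent_finite[OF J]
  \<comment> \<open>The sentinel 0 keeps the set nonempty when no constraint is tight.\<close>
  define Tight where "Tight = insert 0 {x \<in> {1..m}. card (I \<inter> {..x}) = c x}"
  define x where "x = Max Tight"
  have fT: "finite Tight" by (simp add: Tight_def)
  have x: "x \<in> Tight" unfolding x_def using fT by (rule Max_in) (simp add: Tight_def)
  have xmax: "y \<le> x" if "y \<in> Tight" for y
    unfolding x_def using fT that by (rule Max_ge)
  have le: "card (J \<inter> {..x}) \<le> card (I \<inter> {..x})"
  proof (cases "x = 0")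
    case True
    then have "J \<inter> {..x} = {}" using J by (auto simp: independent_def)
    then show ?thesis by (simp only: card.empty zero_le)
  next
    case False
    then have "x \<in> {1..m}" "card (I \<inter> {..x}) = c x" using x by (auto simp: Tight_def)
    then show ?thesis using J by (auto simp: independent_def)
  qed
  have "card K = card (K \<inter> {..x}) + card (K \<inter> {x<..})" if "finite K" for K :: "nat set"
    using that by (subst card_Un_disjoint[symmetric]) (auto intro: arg_cong[where f = card])
  from this[OF fin(1)] this[OF fin(2)] le less
  have "\<not> J \<inter> {x<..} \<subseteq> I \<inter> {x<..}"
    using card_mono[of "I \<inter> {x<..}" "J \<inter> {x<..}"] fin by auto
  then obtain j where j: "j \<in> J" "j \<notin> I" "x < j" by auto
  have "independent (insert j I)"
    unfolding independent_def
  proof (intro conjI ballI)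
    show "insert j I \<subseteq> {1..m}" using I J j by (auto simp: independent_def)
    fix y assume y: "y \<in> {1..m}"
    then have Iy: "card (I \<inter> {..y}) \<le> c y" using I by (auto simp: independent_def)
    show "card (insert j I \<inter> {..y}) \<le> c y"
    proof (cases "j \<le> y")
      case True
      then have "y \<notin> Tight" using xmax j by fastforce
      then have "card (I \<inter> {..y}) < c y" using Iy y by (auto simp: Tight_def)
      then show ?thesis using True fin j by simp
    qed (use Iy in simp)
  qed
  then show ?thesis using j by blast
qed

lemma independent_extend:
  assumes J: "independent J" and k: "k \<le> card J" and I: "independent I" "card I \<le> k"
  shows "\<exists>I'. I \<subseteq> I' \<and> I' \<subseteq> I \<union> J \<and> independent I' \<and> card I' = k"
  using I k
proof (induction "k - card I" arbitrary: I)
  case 0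
  then show ?case by auto
next
  case (Suc d)
  then have "card I < card J" by linarith
  with independent_augment[OF \<open>independent I\<close> J]
  obtain j where j: "j \<in> J - I" "independent (insert j I)" by blast
  have "card (insert j I) = Suc (card I)"
    using j independent_finite Suc by simp
  with Suc.hyps(2) have "d = k - card (insert j I)" "card (insert j I) \<le> k" by linarith+
  from Suc.hyps(1)[OF this(1) j(2) this(2) k] obtain I' where
    "insert j I \<subseteq> I'" "I' \<subseteq> insert j I \<union> J" "independent I'" "card I' = k"
    by blast
  then show ?case using j by auto
qed

section \<open>Optimal column sets when the \<open>r\<close>-th diagonal lies in
  \<open>F\<close>\<close>

context
  fixes r :: nat
  assumes r: "1 \<le> r" "r \<le> m"
    and full: "\<And>k. k \<in> {1..r} \<Longrightarrow> k \<le> c (m - r + k)"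
begin

text \<open>In each of its columns the \<open>i\<close>-th diagonal runs no lower than the
  \<open>r\<close>-th, so it lies in \<open>F\<close> too and occupies the last \<open>i\<close>
  columns.\<close>

lemma card_diag_cols_le:
  assumes "i \<le> r"
  shows "card (diag_cols i) = i"
proof -
  have "diag_cols i = {m - i + 1..m}"
  proof (intro equalityI subsetI)
    fix t assume t: "t \<in> {m - i + 1..m}"
    have "t + r - m \<le> c (m - r + (t + r - m))"
      using t assms r by (intro full) auto
    also have "m - r + (t + r - m) = t" using t assms r by auto
    finally show "t \<in> diag_cols i" using t assms r by (auto simp: diag_cols_def)
  qed (auto simp: diag_cols_def)
  then show ?thesis using assms r by simp
qed

text \<open>For \<open>i \<le> r\<close> the right side is \<open>r\<close>; for
  \<open>i \<ge> m\<close> all heavy columns are diagonal columns. In between, either the last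
  \<open>i\<close> columns all belong to the diagonal and the minimum is \<open>r\<close>, or the
  first gap gives the bound.\<close>

lemma card_heavy_cols_le:
  assumes S: "independent S" "card S = r"
  shows "card (S \<inter> heavy_cols i) \<le> min r (card (diag_cols i)) + (r - i)"
proof -
  note fin = independent_finite[OF S(1)]
  have le_r: "card (S \<inter> heavy_cols i) \<le> r"
    using card_mono[OF fin, of "S \<inter> heavy_cols i"] S by simp
  consider "i \<le> r" | "i \<ge> m" | "r < i" "i < m" "{m - i + 1..m} \<subseteq> diag_cols i"
    | "r < i" "i < m" "\<not> {m - i + 1..m} \<subseteq> diag_cols i"
    by linarith
  then show ?thesis
  proof cases
    case 1
    then show ?thesis using le_r card_diag_cols_le by simp
  next
    case 2
    then have "S \<inter> heavy_cols i \<subseteq> diag_cols i"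
      by (auto simp: heavy_cols_def diag_cols_def)
    then have "card (S \<inter> heavy_cols i) \<le> card (diag_cols i)"
      by (intro card_mono) auto
    then show ?thesis using le_r by simp
  next
    case 3
    then have "i \<le> card (diag_cols i)"
      using card_mono[OF finite_cols(1) 3(3)] by simp
    then show ?thesis using le_r 3 by simp
  next
    case 4
    \<comment> \<open>Up to the first gap \<open>t\<close> there are at most \<open>c t\<close>
      members of \<open>S\<close>, and at least as many diagonal columns precede \<open>t\<close>.
      Heavy columns beyond \<open>t\<close> are diagonal columns themselves.\<close>
    define gap where "gap t \<longleftrightarrow> t \<in> {m - i + 1..m} \<and> t \<notin> diag_cols i" for t
    define t where "t = (LEAST t. gap t)"
    have "\<exists>t. gap t" using 4 by (auto simp: gap_def)
    then have "gap t" unfolding t_def by (rule LeastI_ex)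
    then have t: "t \<in> {1..m}" "m < t + i" "c t + m < t + i"
      using 4 by (auto simp: gap_def diag_cols_def)
    have below: "s \<in> diag_cols i" if "s \<in> {m - i + 1..<t}" for s
      using not_less_Least[of s gap] that t unfolding t_def[symmetric] by (auto simp: gap_def)
    have "S \<inter> heavy_cols i \<subseteq> (S \<inter> {..t}) \<union> (diag_cols i \<inter> {t<..})"
      using t by (auto simp: heavy_cols_def diag_cols_def)
    then have "card (S \<inter> heavy_cols i) \<le> card ((S \<inter> {..t}) \<union> (diag_cols i \<inter> {t<..}))"
      by (intro card_mono) (use fin in auto)
    also have "\<dots> \<le> card (S \<inter> {..t}) + card (diag_cols i \<inter> {t<..})"
      by (rule card_Un_le)
    also have "card (S \<inter> {..t}) \<le> c t"
      using S t by (auto simp: independent_def)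
    also have "c t \<le> card {m - i + 1..<t}"
      using t 4 by simp
    also have "card {m - i + 1..<t} + card (diag_cols i \<inter> {t<..}) =
        card ({m - i + 1..<t} \<union> (diag_cols i \<inter> {t<..}))"
      by (rule card_Un_disjoint[symmetric]) auto
    also have "\<dots> \<le> card (diag_cols i)"
      by (intro card_mono) (use below in auto)
    finally show ?thesis using le_r by simp
  qed
qed

text \<open>Greedy choice by decreasing threshold: at level \<open>i\<close> the set grows by
  columns of \<open>diag_cols i\<close> to size \<open>min r (card (diag_cols i))\<close>, unless
  already that large. It stays inside \<open>heavy_cols i\<close>, so its whole size counts there,
  and growing never lowers the counts at higher levels.\<close>

lemma greedy_independent:
  assumes "r \<le> i" "i \<le> m + n"
  shows "\<exists>S. independent S \<and> S \<subseteq> heavy_cols i \<and> card S \<le> r \<and>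
    (\<forall>k\<ge>i. min r (card (diag_cols k)) \<le> card (S \<inter> heavy_cols k))"
  using assms(2,1)
proof (induction i rule: inc_induct)
  case base
  \<comment> \<open>From index \<open>m + n\<close> on, a diagonal would run below row
    \<open>n\<close> in every column.\<close>
  have "diag_cols k = {}" if "k \<ge> m + n" for k
    using that c_bounds(2) by (fastforce simp: diag_cols_def)
  then show ?case
    by (intro exI[of _ "{}"]) (auto simp: independent_def)
next
  case (step i)
  then obtain S where S: "independent S" "S \<subseteq> heavy_cols (Suc i)" "card S \<le> r"
    and ge: "\<And>k. k \<ge> Suc i \<Longrightarrow> min r (card (diag_cols k)) \<le> card (S \<inter> heavy_cols k)"
    by auto
  obtain S' where S': "S \<subseteq> S'" "S' \<subseteq> S \<union> diag_cols i" "independent S'" "card S' \<le> r"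
    "min r (card (diag_cols i)) \<le> card S'"
  proof (cases "card S \<le> min r (card (diag_cols i))")
    case True
    from independent_extend[OF independent_diag_cols min.cobounded2 S(1) True] obtain I' where
      I': "S \<subseteq> I'" "I' \<subseteq> S \<union> diag_cols i" "independent I'"
        "card I' = min r (card (diag_cols i))"
      by blast
    show ?thesis by (rule that[OF I'(1-3)]) (simp_all add: I'(4))
  next
    case False
    show ?thesis by (rule that[OF _ _ S(1) S(3)]) (use False in auto)
  qed
  have "heavy_cols (Suc i) \<union> diag_cols i \<subseteq> heavy_cols i"
    by (auto simp: heavy_cols_def diag_cols_def)
  then have sub: "S' \<subseteq> heavy_cols i"
    using S'(2) S(2) by blast
  have "min r (card (diag_cols k)) \<le> card (S' \<inter> heavy_cols k)" if "k \<ge> i" for k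
  proof (cases "k = i")
    case True
    then show ?thesis using S' sub by (simp add: Int_absorb2)
  next
    case False
    have "card (S \<inter> heavy_cols k) \<le> card (S' \<inter> heavy_cols k)"
      using S' by (intro card_mono) auto
    then show ?thesis using ge[of k] False that by simp
  qed
  then show ?case using S' sub by blast
qed

text \<open>At level \<open>r\<close> the diagonal has \<open>r\<close> columns, which forces the
  greedy set to size \<open>r\<close>. For smaller indices the level sets contain all of it, so
  every bound of \<open>card_heavy_cols_le\<close> is attained at once.\<close>

lemma ex_optimal_independent:
  "\<exists>S. independent S \<and> card S = r \<and>
    (\<forall>i. card (S \<inter> heavy_cols i) = min r (card (diag_cols i)) + (r - i))"
proof -
  obtain S where S: "independent S" "S \<subseteq> heavy_cols r" "card S \<le> r"
    and ge: "\<And>k. k \<ge> r \<Longrightarrow> min r (card (diag_cols k)) \<le> card (S \<inter> heavy_cols k)"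
    using greedy_independent[of r] r by auto
  have card_S: "card S = r"
    using ge[of r] S card_diag_cols_le[of r] by (simp add: Int_absorb2)
  have "min r (card (diag_cols i)) + (r - i) \<le> card (S \<inter> heavy_cols i)" for i
  proof (cases "i \<le> r")
    case True
    then have "S \<inter> heavy_cols i = S" using S by (fastforce simp: heavy_cols_def)
    then show ?thesis using True card_S card_diag_cols_le by simp
  qed (use ge in simp)
  then show ?thesis
    using S card_S card_heavy_cols_le[OF S(1) card_S] by (intro exI[of _ S]) (auto intro: antisym)
qed

text \<open>The bound on the heavy count is applied termwise; its summand \<open>r - i\<close>
  cancels against the pair count.\<close>

lemma free_cells_ge:
  assumes "independent S" "card S = r"
  shows "(\<Sum>i = 1..m + n - 1. max 0 (int (card (diag_cols i)) - int r)) \<le> free_cells S"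
proof -
  have "S \<subseteq> {1..m}" using assms by (simp add: independent_def)
  show ?thesis
    unfolding free_cells_eq_sum_diagonals[OF \<open>S \<subseteq> {1..m}\<close>]
  proof (rule sum_mono)
    fix i
    show "max 0 (int (card (diag_cols i)) - int r) \<le>
        int (card (diag_cols i)) - int (card (S \<inter> heavy_cols i)) + int (card S - i)"
      using card_heavy_cols_le[OF assms, of i] assms(2) by (simp add: min_def split: if_splits)
  qed
qed

lemma ex_free_cells_eq:
  "\<exists>S. independent S \<and> card S = r \<and>
    free_cells S = (\<Sum>i = 1..m + n - 1. max 0 (int (card (diag_cols i)) - int r))"
proof -
  obtain S where S: "independent S" "card S = r"
    "\<And>i. card (S \<inter> heavy_cols i) = min r (card (diag_cols i)) + (r - i)"
    using ex_optimal_independent by blast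
  moreover have "S \<subseteq> {1..m}" using S by (simp add: independent_def)
  ultimately show ?thesis
    by (intro exI[of _ S]) (auto simp: free_cells_eq_sum_diagonals min_def intro!: sum.cong)
qed

end

section \<open>Rook placements and their column sets\<close>

lemma finite_placement: "C \<subseteq> F \<Longrightarrow> finite C"
  using finite_F finite_subset by blast

text \<open>Rooks in the columns up to \<open>x\<close> stand in distinct rows, all at most
  \<open>c x\<close> by monotonicity.\<close>

lemma independent_placement:
  assumes C: "C \<subseteq> F" "nonattacking n m C"
  shows "independent (snd ` C)"
  unfolding independent_def
proof (intro conjI ballI)
  show "snd ` C \<subseteq> {1..m}" using C subset_F by auto
  fix x assume x: "x \<in> {1..m}"
  let ?L = "{p \<in> C. snd p \<le> x}"
  have "snd ` C \<inter> {..x} = snd ` ?L" by auto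
  then have "card (snd ` C \<inter> {..x}) \<le> card ?L"
    using finite_placement[OF C(1)] by (simp add: card_image_le)
  also have "card ?L = card (fst ` ?L)"
    using nonattacking_inj_on(1)[OF C(2)] by (intro card_image[symmetric]) (auto intro: inj_on_subset)
  also have "\<dots> \<le> card {1..c x}"
  proof (rule card_mono)
    show "fst ` ?L \<subseteq> {1..c x}"
    proof
      fix a assume "a \<in> fst ` ?L"
      then obtain t where t: "(a, t) \<in> F" "t \<le> x" using C by auto
      then show "a \<in> {1..c x}"
        using c_mono[of t x] x by (auto simp: mem_F_iff)
    qed
  qed simp
  finally show "card (snd ` C \<inter> {..x}) \<le> c x" by simp
qed

text \<open>In an unoccupied column exactly the rows of rooks to its left are crossed out, and those
  rows reach it because heights are monotone. The last sum is the excess left in occupied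
  columns.\<close>

lemma rook_inv_eq:
  assumes C: "C \<subseteq> F" "nonattacking n m C"
  shows "int (rook_inv C F) = free_cells (snd ` C) +
    (\<Sum>b\<in>snd ` C. int (card {a. (a, b) \<in> F \<and> \<not> crossed_out C (a, b)}))"
proof -
  let ?S = "snd ` C"
  let ?U = "\<lambda>b. {a. (a, b) \<in> F \<and> \<not> crossed_out C (a, b)}"
  have finU: "finite (?U b)" for b
    by (rule finite_subset[of _ "{1..n}"]) (use subset_F in auto)
  have S: "?S \<subseteq> {1..m}" using C subset_F by auto
  have "rook_inv C F = card (SIGMA b:{1..m}. ?U b)"
    unfolding rook_inv_def
    by (rule bij_betw_same_card[OF bij_betw_byWitness[of _ prod.swap prod.swap]])
      (use subset_F in auto)
  also have "\<dots> = (\<Sum>b = 1..m. card (?U b))"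
    by (rule card_SigmaI) (use finU in auto)
  also have "int \<dots> = (\<Sum>b\<in>{1..m} - ?S. int (card (?U b))) + (\<Sum>b\<in>?S. int (card (?U b)))"
    unfolding of_nat_sum by (rule sum.subset_diff) (use S in auto)
  also have "(\<Sum>b\<in>{1..m} - ?S. int (card (?U b))) = free_cells ?S"
    unfolding free_cells_def
  proof (rule sum.cong[OF refl])
    fix b assume b: "b \<in> {1..m} - ?S"
    let ?L = "{p \<in> C. snd p < b}"
    have finL: "finite ?L" using finite_placement[OF C(1)] by simp
    have inside: "fst ` ?L \<subseteq> {1..c b}"
    proof
      fix a assume "a \<in> fst ` ?L"
      then obtain t where t: "(a, t) \<in> F" "t < b" using C by auto
      then show "a \<in> {1..c b}"
        using c_mono[of t b] b by (auto simp: mem_F_iff)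
    qed
    have ne: "j \<noteq> b" if "(i, j) \<in> C" for i j
      using b that by force
    have "crossed_out C (a, b) \<longleftrightarrow> a \<in> fst ` ?L" for a
      using ne by (fastforce simp: crossed_out_def image_iff le_less)
    then have "?U b = {1..c b} - fst ` ?L"
      using b by (auto simp: mem_F_iff)
    then have "card (?U b) = c b - card (fst ` ?L)"
      using card_Diff_subset[OF _ inside] finL by simp
    moreover have "card (fst ` ?L) \<le> c b"
      using card_mono[OF _ inside] by simp
    moreover have "card (fst ` ?L) = card ?L"
      using nonattacking_inj_on(1)[OF C(2)] by (intro card_image) (auto intro: inj_on_subset)
    moreover have "card ?L = card (snd ` ?L)"
      using nonattacking_inj_on(2)[OF C(2)] by (intro card_image[symmetric]) (auto intro: inj_on_subset)
    moreover have "snd ` ?L = ?S \<inter> {..<b}" by auto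
    ultimately show "int (card (?U b)) = int (c b) - int (card (?S \<inter> {..<b}))"
      by simp
  qed
  finally show ?thesis .
qed

text \<open>Columns are filled from left to right, each rook in the lowest free row. Cells above it
  are crossed out by this rook, cells below it by earlier rooks in their rows.\<close>

lemma ex_lowest_placement:
  assumes S: "independent S" and "x \<le> m"
  shows "\<exists>C. C \<subseteq> F \<and> nonattacking n m C \<and> snd ` C = S \<inter> {..x} \<and>
    (\<forall>b\<in>snd ` C. \<forall>a. (a, b) \<in> F \<longrightarrow> crossed_out C (a, b))"
  using assms(2)
proof (induction x)
  case 0
  have "S \<inter> {..0} = {}" using S by (auto simp: independent_def)
  then show ?case by (intro exI[of _ "{}"]) (auto simp: nonattacking_def)
next
  case (Suc x)
  then have "x \<le> m" by simp
  from Suc.IH[OF this] obtain C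
    where C: "C \<subseteq> F" "nonattacking n m C" "snd ` C = S \<inter> {..x}"
      and crossed: "\<forall>b\<in>snd ` C. \<forall>a. (a, b) \<in> F \<longrightarrow> crossed_out C (a, b)"
    by (elim exE conjE)
  show ?case
  proof (cases "Suc x \<in> S")
    case False
    then have "S \<inter> {..Suc x} = S \<inter> {..x}" by (auto simp: le_Suc_eq)
    with C crossed show ?thesis by (intro exI[of _ C]) simp
  next
    case True
    define free where "free = {1..c (Suc x)} - fst ` C"
    \<comment> \<open>Independence at \<open>Suc x\<close> leaves fewer used rows than cells in that
      column, so some row is free.\<close>
    have "card (fst ` C) = card (snd ` C)"
      using nonattacking_inj_on[OF C(2)] by (simp add: card_image)
    also have "\<dots> = card (S \<inter> {..x})" using C by simp
    also have "\<dots> < card (S \<inter> {..Suc x})"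
      using True independent_finite[OF S] by (simp add: atMost_Suc)
    also have "\<dots> \<le> c (Suc x)" using S Suc by (auto simp: independent_def)
    finally have "\<not> {1..c (Suc x)} \<subseteq> fst ` C"
      using card_mono[of "fst ` C" "{1..c (Suc x)}"] finite_placement[OF C(1)] by auto
    then have "free \<noteq> {}" "finite free" by (auto simp: free_def)
    define a where "a = Max free"
    have a: "a \<in> free" and amax: "\<And>a'. a' \<in> free \<Longrightarrow> a' \<le> a"
      using \<open>free \<noteq> {}\<close> \<open>finite free\<close> by (auto simp: a_def)
    let ?C = "insert (a, Suc x) C"
    have aF: "(a, Suc x) \<in> F" using a Suc by (auto simp: free_def mem_F_iff)
    have old: "snd p \<le> x" "fst p \<noteq> a" if "p \<in> C" for p
      using C(3) a that by (auto simp: free_def)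
    have "nonattacking n m ?C"
      unfolding nonattacking_def
    proof (intro conjI ballI impI)
      show "?C \<subseteq> {1..n} \<times> {1..m}" using C aF subset_F by auto
      fix p q assume pq: "p \<in> ?C" "q \<in> ?C" "p \<noteq> q"
      have "fst p \<noteq> fst q \<and> snd p \<noteq> snd q" if "p \<in> C" "q \<in> C"
        using C(2) pq(3) that unfolding nonattacking_def by blast
      with pq old[of p] old[of q] show "fst p \<noteq> fst q" "snd p \<noteq> snd q"
        by auto
    qed
    moreover have "snd ` ?C = S \<inter> {..Suc x}" using C True by (simp add: atMost_Suc)
    moreover have "crossed_out ?C (a', b)" if mem: "b \<in> snd ` ?C" "(a', b) \<in> F" for a' b
    proof (cases "b \<in> snd ` C")
      case True
      then show ?thesis using crossed[rule_format, OF True mem(2)] by (auto simp: crossed_out_def)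
    next
      case False
      then have b: "b = Suc x" using mem by auto
      show ?thesis
      proof (cases "a' \<le> a")
        case True
        then show ?thesis using b by (auto simp: crossed_out_def)
      next
        case False
        then have "a' \<notin> free" using amax by auto
        then obtain t where "(a', t) \<in> C" using mem(2) b by (auto simp: free_def mem_F_iff)
        then show ?thesis using b old(1)[of "(a', t)"] by (force simp: crossed_out_def)
      qed
    qed
    ultimately show ?thesis using C aF by (intro exI[of _ ?C]) blast
  qed
qed

end

section \<open>From column sets to the trailing degree\<close>

theorem theorem2p15:
  fixes n m r :: nat and F :: "(nat \<times> nat) set"
  assumes "ferrers_diagram n m F"
    and "1 \<le> r" and "r \<le> min n m"
    and "kappa m F r \<ge> 1"
  shows "int (trailing_degree (q_rook_poly n m F r)) =
    (\<Sum>i = 1..m + n - 1. max 0 (int (card (diagonal n m i \<inter> F)) - int r))"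
proof -
  interpret ferrers n m F by unfold_locales (fact assms(1))
  have r: "1 \<le> r" "r \<le> m" using assms by auto
  note full = kappa_pos_imp_le_c[OF r assms(4)]
  define bound where
    "bound = (\<Sum>i = 1..m + n - 1. max 0 (int (card (diag_cols i)) - int r))"
  define P where "P = {C. C \<subseteq> F \<and> nonattacking n m C \<and> card C = r}"
  have finP: "finite P"
    unfolding P_def using finite_F by simp
  have card_snd: "card (snd ` C) = card C" if "nonattacking n m C" for C
    using nonattacking_inj_on(2)[OF that] by (rule card_image)
  have lower: "bound \<le> int (rook_inv C F)" if "C \<in> P" for C
  proof -
    from that have C: "C \<subseteq> F" "nonattacking n m C" "card C = r" by (auto simp: P_def)
    have "bound \<le> free_cells (snd ` C)"
      unfolding bound_def
      by (rule free_cells_ge[OF r full]) (use C card_snd independent_placement in auto)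
    also have "\<dots> \<le> int (rook_inv C F)"
      unfolding rook_inv_eq[OF C(1,2)] by (simp add: sum_nonneg)
    finally show ?thesis .
  qed
  obtain S where S: "independent S" "card S = r" "free_cells S = bound"
    using ex_free_cells_eq[OF r full] unfolding bound_def by blast
  have "S \<inter> {..m} = S" using S by (auto simp: independent_def)
  then obtain C where C: "C \<subseteq> F" "nonattacking n m C" "snd ` C = S"
    "\<forall>b\<in>snd ` C. \<forall>a. (a, b) \<in> F \<longrightarrow> crossed_out C (a, b)"
    using ex_lowest_placement[OF S(1) order_refl] by auto
  \<comment> \<open>The lowest placement has no excess in its own columns, so the lower bound is
    attained.\<close>
  have "(\<Sum>b\<in>snd ` C. int (card {a. (a, b) \<in> F \<and> \<not> crossed_out C (a, b)})) = 0"
    by (rule sum.neutral) (use C(4) in \<open>auto simp: card_eq_0_iff\<close>)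
  then have "int (rook_inv C F) = bound"
    unfolding rook_inv_eq[OF C(1,2)] using C(3) S(3) by simp
  moreover have "C \<in> P" using C S card_snd by (auto simp: P_def)
  ultimately have "trailing_degree (q_rook_poly n m F r) = rook_inv C F"
    unfolding q_rook_poly_def P_def[symmetric]
    by (intro trailing_degree_sum_monom finP) (use lower in force)+
  then show ?thesis
    using \<open>int (rook_inv C F) = bound\<close> by (simp add: bound_def card_diagonal)
qed

end
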